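(* Let $E\subset\mathbb{R}^d$ be the non-autonomous attractor determined by a collection $\mathcal{J}=\{J_{\mathbf u}:\mathbf u\in\Sigma^*\}$ fulfilling the non-autonomous structure with respect to $\{\Xi_k\}_{k\ge1}$, $\Xi_k=\{S_{k,1},\dots,S_{k,n_k}\}$ (see context), and suppose that the gap separation condition holds: there is a constant $C>0$ such that for all $\mathbf u\in\Sigma^*$ and all $i\ne j$ in $\{1,\dots,n_{|\mathbf u|+1}\}$, $$\inf\{|x-y|:x\in J_{\mathbf ui},\ y\in J_{\mathbf uj}\}\ge C|J_{\mathbf u}|.$$ Assume that for every integer $k\ge 1$ and every $i=1,\dots,n_k$ there is a number $0<c_{k,i}<1$ with $$|S_{k,i}(x)-S_{k,i}(y)|\ge c_{k,i}|x-y|\qquad (x,y\in J).$$ For each $k\ge1$ let $d_k$ be the unique real solution of $\prod_{i=1}^{k}\big(\sum_{j=1}^{n_i}(c_{i,j})^{d_k}\big)=1$, and put $d_*=\liminf_{k\to\infty}d_k$, $d^*=\limsup_{k\to\infty}d_k$. Then $$\dim_{\rm H}E\ge d_*,\qquad \overline{\dim}_{\rm B}E\ge d^*.$$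
   Context: Let $\{n_k\}_{k\ge1}$ be integers with $n_k\ge2$. Put $\Sigma^k=\{u_1u_2\cdots u_k:1\le u_j\le n_j,\ j\le k\}$, $\Sigma^0=\{\emptyset\}$ (the empty word) and $\Sigma^*=\bigcup_{k\ge0}\Sigma^k$; $|\mathbf u|=k$ is the length of $\mathbf u\in\Sigma^k$. Let $J\subset\mathbb{R}^d$ be a compact set with non-empty interior. For each $k\ge1$ let $\Xi_k=\{S_{k,1},\dots,S_{k,n_k}\}$ be a collection of contractive mappings of $\mathbb{R}^d$ (each is Lipschitz with some constant in $(0,1)$). A collection $\mathcal{J}=\{J_{\mathbf u}:\mathbf u\in\Sigma^*\}$ of closed subsets of $J$ fulfils the non-autonomous structure with respect to $\{\Xi_k\}$ if: (1) $J_\emptyset=J$, and for all $k\ge1$ and $\mathbf u\in\Sigma^{k-1}$ the sets $J_{\mathbf u1},\dots,J_{\mathbf un_k}$ are subsets of $J_{\mathbf u}$; (2) there are vectors $\omega_{\mathbf v}\in\mathbb{R}^d$ ($\mathbf v\in\Sigma^*\setminus\{\emptyset\}$) such that for each $\mathbf u=u_1\cdots u_k\in\Sigma^*$, $J_{\mathbf u}=\Psi_{\mathbf u}(J)=\Psi_{u_1}\circ\cdots\circ\Psi_{u_k}(J)$, where $\Psi_{u_j}(x)=S_{j,u_j}(x)+\omega_{u_1\cdots u_j}$, $j=1,\dots,k$; (3) $\lim_{k\to\infty}\max_{\mathbf u\in\Sigma^k}|J_{\mathbf u}|=0$, where $|\cdot|$ of a set denotes its diameter. The non-autonomous attractor determined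 by $\mathcal{J}$ is the non-empty compact set $E=\bigcap_{k=1}^\infty\bigcup_{\mathbf u\in\Sigma^k}J_{\mathbf u}$. $\dim_{\rm H}$ and $\overline{\dim}_{\rm B}$ denote Hausdorff and upper box-counting dimension.
   Formalization: The formal theorem also assumes that each map Ψ_v(x) = S_{k,v_k}(x) + ω_v (v a non-empty word) sends J into J; this is automatic for injective S_{k,i}, and without it the statement fails, since the lower bounds are only assumed on J. *)

theory Defs
  imports "HOL-Analysis.Analysis"
begin

section \<open>Hausdorff dimension\<close>

text \<open>
  The summand \<open>|U|^s\<close>, with the usual conventions \<open>|U|^0 = 1\<close> for \<open>U \<noteq> {}\<close> and
  \<open>|{}|^s = 0\<close>; a plain \<open>powr\<close> would give \<open>0 powr 0 = 0\<close> for singletons.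
\<close>

definition diam_pow :: "real \<Rightarrow> 'a::metric_space set \<Rightarrow> ennreal" where
  "diam_pow s U =
     (if U = {} then 0 else if s = 0 then 1 else ennreal (diameter U powr s))"

text \<open>
  Countable covers are sequences (members may be empty). Boundedness is required explicitly
  because \<open>diameter\<close> has an unspecified finite value on unbounded sets.
\<close>

definition hausdorff_premeasure ::
    "real \<Rightarrow> real \<Rightarrow> 'a::metric_space set \<Rightarrow> ennreal" where
  "hausdorff_premeasure s \<delta> E =
     (INF U \<in> {U :: nat \<Rightarrow> 'a set.
                 E \<subseteq> (\<Union>i. U i) \<and> (\<forall>i. bounded (U i) \<and> diameter (U i) \<le> \<delta>)}.
        (\<Sum>i. diam_pow s (U i)))"

definition hausdorff_measure :: "real \<Rightarrow> 'a::metric_space set \<Rightarrow> ennreal" where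
  "hausdorff_measure s E = (SUP \<delta> \<in> {0<..}. hausdorff_premeasure s \<delta> E)"

definition hausdorff_dim :: "'a::metric_space set \<Rightarrow> ereal" where
  "hausdorff_dim E = (INF s \<in> {s. 0 \<le> s \<and> hausdorff_measure s E = 0}. ereal s)"

section \<open>Upper box-counting dimension\<close>

text \<open>
  The least number of sets of diameter at most \<open>\<delta>\<close> covering \<open>E\<close>. This and the dimension
  below are meaningful for non-empty totally bounded \<open>E\<close>.
\<close>

definition box_count :: "real \<Rightarrow> 'a::metric_space set \<Rightarrow> nat" where
  "box_count \<delta> E =
     Inf {card \<U> | \<U>. finite \<U> \<and> E \<subseteq> \<Union>\<U> \<and> (\<forall>U\<in>\<U>. bounded U \<and> diameter U \<le> \<delta>)}"

definition upper_box_dim :: "'a::metric_space set \<Rightarrow> ereal" where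
  "upper_box_dim E =
     Limsup (at_right 0) (\<lambda>\<delta>. ereal (ln (real (box_count \<delta> E)) / - ln \<delta>))"

section \<open>Non-autonomous structures\<close>

definition words_of_length :: "(nat \<Rightarrow> nat) \<Rightarrow> nat \<Rightarrow> nat list set" where
  "words_of_length n k =
     {u. length u = k \<and> (\<forall>j<k. 1 \<le> u ! j \<and> u ! j \<le> n (Suc j))}"

definition words :: "(nat \<Rightarrow> nat) \<Rightarrow> nat list set" where
  "words n = (\<Union>k. words_of_length n k)"

text \<open>
  For a non-empty word \<open>v = u\<^sub>1\<dots>u\<^sub>j\<close> this is the map \<open>x \<mapsto> S\<^bsub>j,u\<^sub>j\<^esub>(x) + \<omega>\<^bsub>v\<^esub>\<close>,
  written \<open>\<Psi>\<^bsub>u\<^sub>j\<^esub>\<close> in the literature. It depends on the whole prefix \<open>v\<close>, not just on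
  the letter \<open>u\<^sub>j\<close>, so it is indexed by \<open>v\<close> here.
\<close>

definition level_map ::
    "(nat \<Rightarrow> nat \<Rightarrow> 'a::real_normed_vector \<Rightarrow> 'a) \<Rightarrow> (nat list \<Rightarrow> 'a) \<Rightarrow> nat list \<Rightarrow> 'a \<Rightarrow> 'a"
  where "level_map S \<omega> v x = S (length v) (last v) x + \<omega> v"

text \<open>
  \<open>\<Psi>\<^sub>u = \<Psi>\<^bsub>u\<^sub>1\<^esub> \<circ> \<dots> \<circ> \<Psi>\<^bsub>u\<^sub>k\<^esub>\<close>; the \<open>j\<close>-th factor belongs to the prefix \<open>take j u\<close>.
\<close>

definition word_map ::
    "(nat \<Rightarrow> nat \<Rightarrow> 'a::real_normed_vector \<Rightarrow> 'a) \<Rightarrow> (nat list \<Rightarrow> 'a) \<Rightarrow> nat list \<Rightarrow> 'a \<Rightarrow> 'a"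
  where "word_map S \<omega> u =
     foldr (\<lambda>j f. level_map S \<omega> (take j u) \<circ> f) [1..<Suc (length u)] id"

definition contractive :: "('a::metric_space \<Rightarrow> 'a) \<Rightarrow> bool" where
  "contractive f \<longleftrightarrow> (\<exists>L. 0 < L \<and> L < 1 \<and> L-lipschitz_on UNIV f)"

text \<open>The value \<open>n 0\<close> and the maps \<open>S 0 i\<close> are never used: levels are numbered from 1.\<close>

definition nonautonomous_structure ::
    "(nat \<Rightarrow> nat) \<Rightarrow> 'a::euclidean_space set \<Rightarrow> (nat \<Rightarrow> nat \<Rightarrow> 'a \<Rightarrow> 'a) \<Rightarrow>
     (nat list \<Rightarrow> 'a) \<Rightarrow> (nat list \<Rightarrow> 'a set) \<Rightarrow> bool" where
  "nonautonomous_structure n J S \<omega> Jf \<longleftrightarrow>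
     (\<forall>u\<in>words n. closed (Jf u) \<and> Jf u \<subseteq> J) \<and>
     Jf [] = J \<and>
     (\<forall>k\<ge>1. \<forall>u\<in>words_of_length n (k - 1). \<forall>i\<in>{1..n k}. Jf (u @ [i]) \<subseteq> Jf u) \<and>
     (\<forall>u\<in>words n. Jf u = word_map S \<omega> u ` J) \<and>
     (\<lambda>k. Max ((\<lambda>u. diameter (Jf u)) ` words_of_length n k)) \<longlonglongrightarrow> 0"

text \<open>
  The inclusion \<open>J\<^bsub>ui\<^esub> \<subseteq> J\<^sub>u\<close> says \<open>\<Psi>\<^sub>u(\<Psi>\<^bsub>ui\<^esub>(J)) \<subseteq> \<Psi>\<^sub>u(J)\<close>. When the
  \<open>S\<^bsub>k,i\<^esub>\<close> are injective this is the same as \<open>\<Psi>\<^bsub>ui\<^esub>(J) \<subseteq> J\<close>, but in general it is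
  weaker, and then bounds on the \<open>S\<^bsub>k,i\<^esub>\<close> over \<open>J\<close> say nothing about the composition
  \<open>\<Psi>\<^sub>u\<close>. The predicate below states that every factor maps \<open>J\<close> into itself, so that the
  composition takes place inside \<open>J\<close>.
\<close>

definition maps_within ::
    "(nat \<Rightarrow> nat) \<Rightarrow> 'a::euclidean_space set \<Rightarrow> (nat \<Rightarrow> nat \<Rightarrow> 'a \<Rightarrow> 'a) \<Rightarrow>
     (nat list \<Rightarrow> 'a) \<Rightarrow> bool" where
  "maps_within n J S \<omega> \<longleftrightarrow> (\<forall>v\<in>words n - {[]}. level_map S \<omega> v ` J \<subseteq> J)"

definition nonautonomous_attractor ::
    "(nat \<Rightarrow> nat) \<Rightarrow> (nat list \<Rightarrow> 'a set) \<Rightarrow> 'a set" where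
  "nonautonomous_attractor n Jf = (\<Inter>k\<in>{1..}. \<Union>u\<in>words_of_length n k. Jf u)"

definition gap_separation ::
    "(nat \<Rightarrow> nat) \<Rightarrow> (nat list \<Rightarrow> 'a::metric_space set) \<Rightarrow> bool" where
  "gap_separation n Jf \<longleftrightarrow>
     (\<exists>C>0. \<forall>u\<in>words n. \<forall>i\<in>{1..n (length u + 1)}. \<forall>j\<in>{1..n (length u + 1)}. i \<noteq> j \<longrightarrow>
        setdist (Jf (u @ [i])) (Jf (u @ [j])) \<ge> C * diameter (Jf u))"

definition level_exponent :: "(nat \<Rightarrow> nat) \<Rightarrow> (nat \<Rightarrow> nat \<Rightarrow> real) \<Rightarrow> nat \<Rightarrow> real" where
  "level_exponent n c k = (THE s. (\<Prod>i=1..k. \<Sum>j=1..n i. c i j powr s) = 1)"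

end

theory Submission
  imports Defs
begin

text \<open>
  Write \<open>c\<^sub>u\<close> for the product of the lower Lipschitz constants along a word \<open>u\<close>. The diameter of
  \<open>J\<^sub>u\<close> is at least \<open>c\<^sub>u |J|\<close>, so by gap separation two children of \<open>J\<^sub>u\<close> are at distance at least
  \<open>K c\<^sub>u\<close> with \<open>K = C |J|\<close>. If \<open>s < d\<^sub>k\<close>, the sum \<open>P\<^sub>k(s)\<close> of \<open>c\<^sub>u\<^sup>s\<close> over the words of length \<open>k\<close>
  exceeds 1.

  For the Hausdorff dimension, give \<open>u\<close> the mass \<open>c\<^sub>u\<^sup>s / P\<^bsub>|u|\<^esub>(s)\<close>, which is additive over children.
  A set \<open>U\<close> meeting two children of \<open>J\<^sub>u\<close> has diameter at least \<open>K c\<^sub>u\<close>, hence dominates the mass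
  of \<open>u\<close>. Compactness reduces a countable cover to finitely many pieces, so no measure on \<open>E\<close>
  has to be constructed. For the box dimension, group the words of one length by the dyadic size of \<open>c\<^sub>u\<close>:
  each group gives a separated set in \<open>E\<close>, so box counts bound \<open>P\<^sub>k(t)\<close>.
\<close>

section \<open>Words and level sums\<close>

lemma words_of_length_0: "words_of_length n 0 = {[]}"
  by (auto simp: words_of_length_def)

lemma snoc_in_words_of_length_iff:
  "u @ [i] \<in> words_of_length n (Suc k) \<longleftrightarrow> u \<in> words_of_length n k \<and> i \<in> {1..n (Suc k)}"
  by (auto simp: words_of_length_def nth_append less_Suc_eq)

lemma words_of_length_Suc:
  "words_of_length n (Suc k) = (\<lambda>(u, i). u @ [i]) ` (words_of_length n k \<times> {1..n (Suc k)})"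
proof (intro subset_antisym subsetI)
  fix v assume v: "v \<in> words_of_length n (Suc k)"
  then have "length v = Suc k"
    by (simp add: words_of_length_def)
  then obtain u i where "v = u @ [i]"
    by (metis append_butlast_last_id list.size(3) nat.distinct(1))
  with v show "v \<in> (\<lambda>(u, i). u @ [i]) ` (words_of_length n k \<times> {1..n (Suc k)})"
    by (auto simp: snoc_in_words_of_length_iff)
qed (auto simp: snoc_in_words_of_length_iff)

lemma words_of_length_SucE:
  assumes "v \<in> words_of_length n (Suc k)"
  obtains u i where "v = u @ [i]" "u \<in> words_of_length n k" "i \<in> {1..n (Suc k)}"
  using assms by (auto simp: words_of_length_Suc)

lemma finite_words_of_length: "finite (words_of_length n k)"
  by (induction k) (auto simp: words_of_length_0 words_of_length_Suc)

lemma sum_words_of_length_Suc: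
  "(\<Sum>v\<in>words_of_length n (Suc k). f v) = (\<Sum>u\<in>words_of_length n k. \<Sum>i=1..n (Suc k). f (u @ [i]))"
proof -
  have "inj_on (\<lambda>(u, i). u @ [i]) (words_of_length n k \<times> {1..n (Suc k)})"
    by (auto simp: inj_on_def)
  then show ?thesis
    by (simp add: words_of_length_Suc sum.reindex sum.cartesian_product case_prod_beta')
qed

lemma length_words_of_length: "u \<in> words_of_length n k \<Longrightarrow> length u = k"
  by (simp add: words_of_length_def)

lemma words_of_length_in_words: "u \<in> words_of_length n k \<Longrightarrow> u \<in> words n"
  by (auto simp: words_def)

lemma words_in_words_of_length: "u \<in> words n \<Longrightarrow> u \<in> words_of_length n (length u)"
  by (auto simp: words_def words_of_length_def)

lemma take_in_words_of_length:
  "v \<in> words_of_length n k \<Longrightarrow> l \<le> k \<Longrightarrow> take l v \<in> words_of_length n l"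
  by (auto simp: words_of_length_def)

section \<open>Weights of words and level sums\<close>

definition word_weight :: "(nat \<Rightarrow> nat \<Rightarrow> real) \<Rightarrow> nat list \<Rightarrow> real" where
  "word_weight c u = (\<Prod>j<length u. c (Suc j) (u ! j))"

lemma word_weight_Nil [simp]: "word_weight c [] = 1"
  by (simp add: word_weight_def)

lemma word_weight_snoc: "word_weight c (u @ [i]) = word_weight c u * c (Suc (length u)) i"
  by (simp add: word_weight_def nth_append)

definition level_sum :: "(nat \<Rightarrow> nat) \<Rightarrow> (nat \<Rightarrow> nat \<Rightarrow> real) \<Rightarrow> nat \<Rightarrow> real \<Rightarrow> real" where
  "level_sum n c k s = (\<Prod>i=1..k. \<Sum>j=1..n i. c i j powr s)"

lemma level_sum_Suc:
  "level_sum n c (Suc k) s = level_sum n c k s * (\<Sum>j=1..n (Suc k). c (Suc k) j powr s)"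
  by (simp add: level_sum_def)

lemma level_sum_pos:
  assumes "\<And>k. 1 \<le> k \<Longrightarrow> 1 \<le> n k" "\<And>k i. 1 \<le> k \<Longrightarrow> i \<in> {1..n k} \<Longrightarrow> 0 < c k i"
  shows "0 < level_sum n c k s"
  unfolding level_sum_def
proof (intro prod_pos sum_pos)
  fix i j assume "i \<in> {1..k}" "j \<in> {1..n i}"
  then show "0 < c i j powr s"
    using assms(2)[of i j] by simp
next
  fix i assume "i \<in> {1..k}"
  then show "{1..n i} \<noteq> {}"
    using assms(1)[of i] by simp
qed simp

lemma level_sum_strict_antimono:
  assumes n: "\<And>k. 1 \<le> k \<Longrightarrow> 1 \<le> n k"
    and c: "\<And>k i. 1 \<le> k \<Longrightarrow> i \<in> {1..n k} \<Longrightarrow> 0 < c k i \<and> c k i < 1"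
    and k: "1 \<le> k" and "s < t"
  shows "level_sum n c k t < level_sum n c k s"
  unfolding level_sum_def
proof (rule prod_mono_strict)
  have less: "(\<Sum>j=1..n i. c i j powr t) < (\<Sum>j=1..n i. c i j powr s)" if "1 \<le> i" for i
    using n[OF that] c[OF that] \<open>s < t\<close> by (intro sum_strict_mono powr_less_mono') force+
  then show "1 \<in> {1..k}" "(\<Sum>j=1..n 1. c 1 j powr t) < (\<Sum>j=1..n 1. c 1 j powr s)"
    using k by auto
  fix i assume "i \<in> {1..k}"
  then show "0 \<le> (\<Sum>j=1..n i. c i j powr t) \<and> (\<Sum>j=1..n i. c i j powr t) \<le> (\<Sum>j=1..n i. c i j powr s)"
    and "0 < (\<Sum>j=1..n i. c i j powr s)"
    using less[of i] sum_nonneg[of "{1..n i}" "\<lambda>j. c i j powr t"] by auto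
qed simp

text \<open>This gives meaning to the \<open>THE\<close> in \<open>level_exponent\<close>: the level
  sum is continuous and strictly decreasing in the exponent, is at least 1 at 0, where it counts
  words, and tends to 0 at infinity.\<close>

lemma level_sum_level_exponent:
  assumes n: "\<And>k. 1 \<le> k \<Longrightarrow> 1 \<le> n k"
    and c: "\<And>k i. 1 \<le> k \<Longrightarrow> i \<in> {1..n k} \<Longrightarrow> 0 < c k i \<and> c k i < 1"
    and k: "1 \<le> k"
  shows "level_sum n c k (level_exponent n c k) = 1"
proof -
  have antimono: "level_sum n c k t < level_sum n c k s" if "s < t" for s t
    by (rule level_sum_strict_antimono) (use assms that in auto)
  have cont: "continuous_on UNIV (level_sum n c k)"
    unfolding level_sum_def using c
    by (intro continuous_on_prod continuous_on_sum continuous_on_powr continuous_on_const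
        continuous_on_id) force
  have ge: "1 \<le> level_sum n c k 0"
    unfolding level_sum_def
  proof (rule prod_ge_1)
    fix i assume "i \<in> {1..k}"
    then have i: "1 \<le> i"
      by simp
    have "(\<Sum>j=1..n i. c i j powr 0) = (\<Sum>j=1..n i. 1)"
      using c[OF i] by (intro sum.cong) force+
    then show "1 \<le> (\<Sum>j=1..n i. c i j powr 0)"
      using n[OF i] by simp
  qed
  have "((\<lambda>s. c i j powr s) \<longlongrightarrow> 0) at_top" if "i \<in> {1..k}" "j \<in> {1..n i}" for i j
  proof -
    have "0 < c i j" "ln (c i j) < 0"
      using c[of i j] that by auto
    then have "filterlim (\<lambda>s. ln (c i j) * s) at_bot at_top"
      by (intro filterlim_tendsto_neg_mult_at_bot[OF tendsto_const] filterlim_ident)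
    then show ?thesis
      using \<open>0 < c i j\<close> by (auto simp: powr_def mult.commute intro: filterlim_compose[OF exp_at_bot])
  qed
  then have "((\<lambda>s. level_sum n c k s) \<longlongrightarrow> (\<Prod>i=1..k. \<Sum>j=1..n i. 0)) at_top"
    unfolding level_sum_def by (intro tendsto_prod tendsto_sum) auto
  \<comment> \<open>Each factor tends to 0, but the product does so only because
    \<open>1 \<le> k\<close>: the empty product is 1.\<close>
  then have "((\<lambda>s. level_sum n c k s) \<longlongrightarrow> 0) at_top"
    using k by (simp add: zero_power)
  then have "eventually (\<lambda>s. level_sum n c k s < 1 \<and> 0 \<le> s) at_top"
    by (intro eventually_conj eventually_ge_at_top order_tendstoD(2)[where y = 0]) simp_all
  then obtain b where "0 \<le> b" "level_sum n c k b < 1"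
    by (auto simp: eventually_at_top_linorder)
  then obtain s where s: "level_sum n c k s = 1"
    using IVT2'[of "level_sum n c k" b 1 0] ge continuous_on_subset[OF cont] by auto
  have "level_exponent n c k = (THE s. level_sum n c k s = 1)"
    by (simp add: level_exponent_def level_sum_def)
  moreover have "(THE s. level_sum n c k s = 1) = s"
  proof (rule the_equality)
    fix r assume "level_sum n c k r = 1"
    with s show "r = s"
      using antimono[of r s] antimono[of s r]
      by (cases r s rule: linorder_cases) auto
  qed (rule s)
  ultimately show ?thesis
    using s by simp
qed

lemma level_sum_gt_1:
  assumes n: "\<And>k. 1 \<le> k \<Longrightarrow> 1 \<le> n k"
    and c: "\<And>k i. 1 \<le> k \<Longrightarrow> i \<in> {1..n k} \<Longrightarrow> 0 < c k i \<and> c k i < 1"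
    and k: "1 \<le> k" and "s < level_exponent n c k"
  shows "1 < level_sum n c k s"
proof -
  have "level_sum n c k (level_exponent n c k) < level_sum n c k s"
    by (rule level_sum_strict_antimono) (use assms in auto)
  moreover have "level_sum n c k (level_exponent n c k) = 1"
    by (rule level_sum_level_exponent) (use assms in auto)
  ultimately show ?thesis
    by simp
qed

section \<open>Gap-separated codes\<close>

text \<open>A set of diameter at most \<delta> contains at most one of the points
  \<open>x u\<close>. Compactness supplies a finite cover, without which \<open>box_count\<close>
  would be the infimum of the empty set, that is 0.\<close>

lemma box_count_lower_bound:
  fixes E :: "'a::metric_space set"
  assumes "compact E" "0 < \<delta>"
    and "\<And>u. u \<in> A \<Longrightarrow> x u \<in> E"
    and "\<And>u v. u \<in> A \<Longrightarrow> v \<in> A \<Longrightarrow> u \<noteq> v \<Longrightarrow> \<delta> < dist (x u) (x v)"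
  shows "card A \<le> box_count \<delta> E"
proof -
  let ?N = "{card \<U> | \<U>. finite \<U> \<and> E \<subseteq> \<Union>\<U> \<and> (\<forall>U\<in>\<U>. bounded U \<and> diameter U \<le> \<delta>)}"
  obtain k where k: "finite k" "E \<subseteq> (\<Union>z\<in>k. ball z (\<delta> / 2))"
    using seq_compact_imp_totally_bounded[of E] \<open>compact E\<close> \<open>0 < \<delta>\<close>
    by (metis compact_imp_seq_compact half_gt_zero)
  have diam: "diameter (ball z (\<delta> / 2)) \<le> \<delta>" for z :: 'a
  proof -
    have "dist a b \<le> \<delta>" if "dist z a < \<delta> / 2" "dist z b < \<delta> / 2" for a b
      using dist_triangle_half_r[OF that] by simp
    then show ?thesis
      using \<open>0 < \<delta>\<close> by (auto simp: diameter_def intro!: cSUP_least)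
  qed
  have "card ((\<lambda>z. ball z (\<delta> / 2)) ` k) \<in> ?N"
    using k diam by (intro CollectI exI[of _ "(\<lambda>z. ball z (\<delta> / 2)) ` k"]) auto
  then have "Inf ?N \<in> ?N"
    by (intro Inf_nat_def1) blast
  then obtain \<U> where \<U>: "box_count \<delta> E = card \<U>" "finite \<U>" "E \<subseteq> \<Union>\<U>"
      "\<And>U. U \<in> \<U> \<Longrightarrow> bounded U \<and> diameter U \<le> \<delta>"
    by (auto simp: box_count_def)
  have "\<forall>u\<in>A. \<exists>U. U \<in> \<U> \<and> x u \<in> U"
    using assms(3) \<U>(3) by blast
  then obtain f where f: "\<And>u. u \<in> A \<Longrightarrow> f u \<in> \<U> \<and> x u \<in> f u"
    by metis
  have "inj_on f A"
  proof (rule inj_onI, rule ccontr)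
    fix u v assume *: "u \<in> A" "v \<in> A" "f u = f v" "u \<noteq> v"
    then have "dist (x u) (x v) \<le> diameter (f u)"
      using f \<U>(4) by (metis diameter_bounded_bound)
    also have "\<dots> \<le> \<delta>"
      using f \<U>(4) * by blast
    finally show False
      using assms(4)[OF *(1,2,4)] by simp
  qed
  then show ?thesis
    unfolding \<U>(1) using f \<U>(2) by (intro card_inj_on_le) auto
qed

text \<open>Both dimension bounds use the maps only through these facts about pieces and weights.
  Smallness of the weights is a separate assumption: even factors below 1 may approach 1 so fast
  that their products stay away from 0.\<close>

locale gap_separated_code =
  fixes n :: "nat \<Rightarrow> nat" and c :: "nat \<Rightarrow> nat \<Rightarrow> real"
    and Jf :: "nat list \<Rightarrow> 'a::heine_borel set" and K :: real
  assumes n_ge_1: "\<And>k. 1 \<le> k \<Longrightarrow> 1 \<le> n k"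
    and c_pos: "\<And>k i. 1 \<le> k \<Longrightarrow> i \<in> {1..n k} \<Longrightarrow> 0 < c k i"
    and c_le_1: "\<And>k i. 1 \<le> k \<Longrightarrow> i \<in> {1..n k} \<Longrightarrow> c k i \<le> 1"
    and K_pos: "0 < K"
    and compact_piece: "\<And>u. u \<in> words n \<Longrightarrow> compact (Jf u)"
    and piece_nonempty: "\<And>u. u \<in> words n \<Longrightarrow> Jf u \<noteq> {}"
    and piece_snoc_subset:
      "\<And>k u i. u \<in> words_of_length n k \<Longrightarrow> i \<in> {1..n (Suc k)} \<Longrightarrow> Jf (u @ [i]) \<subseteq> Jf u"
    and siblings_separated:
      "\<And>k u i j x y. u \<in> words_of_length n k \<Longrightarrow> i \<in> {1..n (Suc k)} \<Longrightarrow> j \<in> {1..n (Suc k)} \<Longrightarrow>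
         i \<noteq> j \<Longrightarrow> x \<in> Jf (u @ [i]) \<Longrightarrow> y \<in> Jf (u @ [j]) \<Longrightarrow> K * word_weight c u \<le> dist x y"
    and weights_small:
      "\<And>\<epsilon>. 0 < \<epsilon> \<Longrightarrow> \<forall>\<^sub>F k in sequentially. \<forall>u\<in>words_of_length n k. word_weight c u < \<epsilon>"
begin

abbreviation "E \<equiv> nonautonomous_attractor n Jf"

section \<open>Geometry of the pieces and of the attractor\<close>

lemma weight_pos: "u \<in> words_of_length n k \<Longrightarrow> 0 < word_weight c u"
  unfolding word_weight_def words_of_length_def by (intro prod_pos c_pos) auto

lemma weight_snoc_le:
  assumes "u \<in> words_of_length n k" "i \<in> {1..n (Suc k)}"
  shows "word_weight c (u @ [i]) \<le> word_weight c u"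
  using weight_pos[OF assms(1)] c_le_1[of "Suc k" i] assms
  by (simp add: word_weight_snoc length_words_of_length mult_left_le)

text \<open>Going back along the two words leads to the ancestor at which they branch, where the
  sibling gap applies. Its weight is at least that of \<open>u\<close>, and nesting keeps
  \<open>x\<close> and \<open>y\<close> in the pieces of the ancestors.\<close>

lemma distinct_words_separated:
  assumes "u \<in> words_of_length n k" "v \<in> words_of_length n k" "u \<noteq> v" "x \<in> Jf u" "y \<in> Jf v"
  shows "K * word_weight c u \<le> dist x y"
  using assms
proof (induction k arbitrary: u v)
  case 0
  then show ?case
    by (simp add: words_of_length_0)
next
  case (Suc k)
  obtain u' i where u: "u = u' @ [i]" "u' \<in> words_of_length n k" "i \<in> {1..n (Suc k)}"
    using Suc.prems(1) by (rule words_of_length_SucE)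
  obtain v' j where v: "v = v' @ [j]" "v' \<in> words_of_length n k" "j \<in> {1..n (Suc k)}"
    using Suc.prems(2) by (rule words_of_length_SucE)
  have "K * word_weight c u \<le> K * word_weight c u'"
    using weight_snoc_le[OF u(2,3)] K_pos u(1) by simp
  also have "\<dots> \<le> dist x y"
  proof (cases "u' = v'")
    case True
    then show ?thesis
      using siblings_separated[of u' k i j x y] Suc.prems u v by auto
  next
    case False
    then show ?thesis
      using Suc.IH[OF u(2) v(2)] Suc.prems(4,5) piece_snoc_subset u v by blast
  qed
  finally show ?case .
qed

lemma piece_word_unique:
  assumes "u \<in> words_of_length n k" "v \<in> words_of_length n k" "x \<in> Jf u" "x \<in> Jf v"
  shows "u = v"
  using distinct_words_separated[OF assms(1,2) _ assms(3,4)] weight_pos[OF assms(1)] K_pos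
  by (auto simp: mult_le_0_iff)

lemma piece_subset_take:
  assumes "v \<in> words_of_length n k" "l \<le> k"
  shows "Jf v \<subseteq> Jf (take l v)"
  using assms
proof (induction k arbitrary: v)
  case (Suc k)
  obtain u i where v: "v = u @ [i]" "u \<in> words_of_length n k" "i \<in> {1..n (Suc k)}"
    using Suc.prems(1) by (rule words_of_length_SucE)
  show ?case
  proof (cases "l = Suc k")
    case True
    then show ?thesis
      using length_words_of_length[OF Suc.prems(1)] by simp
  next
    case False
    then have "take l v = take l u" "l \<le> k"
      using Suc.prems(2) length_words_of_length[OF v(2)] v(1) by auto
    then show ?thesis
      using Suc.IH[OF v(2)] piece_snoc_subset[OF v(2,3)] v(1) by auto
  qed
qed (simp add: words_of_length_0)

lemma attractor_pieceE:
  assumes "x \<in> E"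
  obtains u where "u \<in> words_of_length n k" "x \<in> Jf u"
proof -
  \<comment> \<open>The intersection defining \<open>E\<close> starts at level 1; passing through
    level \<open>Suc k\<close> and truncating also covers \<open>k = 0\<close>.\<close>
  obtain v where v: "v \<in> words_of_length n (Suc k)" "x \<in> Jf v"
    using assms by (force simp: nonautonomous_attractor_def)
  show ?thesis
  proof (rule that)
    show "take k v \<in> words_of_length n k"
      using v(1) by (rule take_in_words_of_length) simp
    show "x \<in> Jf (take k v)"
      using piece_subset_take[OF v(1), of k] v(2) by auto
  qed
qed

text \<open>Appending the letter 1 forever gives nested non-empty compact pieces, and a common point
  of them lies in \<open>E\<close>.\<close>

lemma piece_meets_attractor:
  assumes u: "u \<in> words_of_length n k"
  shows "Jf u \<inter> E \<noteq> {}"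
proof -
  define w where "w m = u @ replicate m 1" for m
  have w: "w m \<in> words_of_length n (k + m)" for m
  proof -
    have "1 \<le> n (Suc j)" for j
      by (rule n_ge_1) simp
    then show ?thesis
      using u by (auto simp: w_def words_of_length_def nth_append)
  qed
  have "\<Inter>(range (\<lambda>m. Jf (w m))) \<noteq> {}"
  proof (rule compact_nest)
    fix m m' :: nat assume "m \<le> m'"
    then have "take (k + m) (w m') = w m"
      using length_words_of_length[OF u] by (simp add: w_def)
    then show "Jf (w m') \<subseteq> Jf (w m)"
      using piece_subset_take[OF w, of "k + m" m'] \<open>m \<le> m'\<close> by simp
  qed (intro compact_piece piece_nonempty words_of_length_in_words[OF w])+
  then obtain x where x: "\<And>m. x \<in> Jf (w m)"
    by blast
  have "x \<in> E"
    unfolding nonautonomous_attractor_def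
  proof (intro INT_I UN_I)
    fix l
    \<comment> \<open>The word \<open>w l\<close> has length \<open>k + l\<close>, so it can be
      truncated at \<open>l\<close> whether or not \<open>l\<close> exceeds
      \<open>k\<close>.\<close>
    show "take l (w l) \<in> words_of_length n l"
      using w by (rule take_in_words_of_length) simp
    show "x \<in> Jf (take l (w l))"
      using piece_subset_take[OF w, of l l] x by auto
  qed
  then show ?thesis
    using x[of 0] by (auto simp: w_def)
qed

lemma compact_attractor: "compact E"
proof -
  have "compact (\<Union>u\<in>words_of_length n k. Jf u)" for k
    using words_of_length_in_words
    by (intro compact_UN finite_words_of_length compact_piece) auto
  then show ?thesis
    unfolding nonautonomous_attractor_def by (intro compact_Inter) auto
qed

text \<open>The pieces are closed, but relative to \<open>E\<close> they are also open: on
  \<open>E\<close>, the piece of \<open>u i\<close> is cut out by the complement \<open>V i\<close>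
  of the finitely many other pieces of the same length. So compactness of \<open>E\<close> applies
  to a cover by pieces.\<close>

lemma finite_subcover_by_pieces:
  assumes "\<And>i. u i \<in> words n" "E \<subseteq> (\<Union>i. Jf (u i))"
  obtains F where "finite F" "E \<subseteq> (\<Union>i\<in>F. Jf (u i))"
proof -
  define V where "V i = - (\<Union>v\<in>words_of_length n (length (u i)) - {u i}. Jf v)" for i
  have op: "open (V i)" for i
    unfolding V_def
    by (intro open_Compl closed_UN finite_Diff finite_words_of_length ballI
        compact_imp_closed compact_piece) (auto intro: words_of_length_in_words)
  have u: "u i \<in> words_of_length n (length (u i))" for i
    by (rule words_in_words_of_length[OF assms(1)])
  have "E \<subseteq> (\<Union>i. V i)"
    using assms(2) piece_word_unique[OF u] by (fastforce simp: V_def)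
  then obtain F where F: "finite F" "E \<subseteq> (\<Union>i\<in>F. V i)"
    using compactE_image[where C = UNIV and f = V, OF compact_attractor op] by metis
  have "E \<inter> V i \<subseteq> Jf (u i)" for i
    unfolding V_def by (blast elim: attractor_pieceE)
  then have "E \<subseteq> (\<Union>i\<in>F. Jf (u i))"
    using F(2) by blast
  with F(1) show ?thesis
    by (rule that)
qed

section \<open>Mass distribution over words and Hausdorff measure\<close>

definition word_mass :: "real \<Rightarrow> nat list \<Rightarrow> real" where
  "word_mass s u = word_weight c u powr s / level_sum n c (length u) s"

lemma level_sum_positive: "0 < level_sum n c k s"
  by (rule level_sum_pos[OF n_ge_1 c_pos])

lemma word_mass_nonneg: "0 \<le> word_mass s u"
  using level_sum_positive by (simp add: word_mass_def less_imp_le)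

text \<open>The factor \<open>?a\<close> depends only on the level, not on \<open>u\<close>, and is
  exactly the growth of the level sum from \<open>k\<close> to \<open>Suc k\<close>.\<close>

lemma sum_word_mass_snoc:
  assumes u: "u \<in> words_of_length n k"
  shows "(\<Sum>i=1..n (Suc k). word_mass s (u @ [i])) = word_mass s u"
proof -
  let ?a = "\<Sum>i=1..n (Suc k). c (Suc k) i powr s"
  have "?a > 0"
    using level_sum_positive[of k s] level_sum_positive[of "Suc k" s]
    by (simp add: level_sum_Suc zero_less_mult_iff)
  have "word_mass s (u @ [i]) = word_mass s u / ?a * c (Suc k) i powr s" if "i \<in> {1..n (Suc k)}" for i
    using weight_pos[OF u] c_pos[of "Suc k" i] that
    by (simp add: word_mass_def word_weight_snoc length_words_of_length[OF u] powr_mult level_sum_Suc)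
  then have "(\<Sum>i=1..n (Suc k). word_mass s (u @ [i])) = word_mass s u / ?a * ?a"
    by (simp add: sum_distrib_left)
  then show ?thesis
    using \<open>?a > 0\<close> by simp
qed

text \<open>The sum runs over all words of length \<open>k\<close>, with the test inside, so that in
  \<open>word_mass_cover\<close> it can be exchanged with a sum over the covering words.\<close>

lemma sum_word_mass_extensions:
  assumes u: "u \<in> words_of_length n l" and "l \<le> k"
  shows "(\<Sum>v\<in>words_of_length n k. if take l v = u then word_mass s v else 0) = word_mass s u"
  using \<open>l \<le> k\<close>
proof (induction k rule: dec_induct)
  case base
  have "(\<Sum>v\<in>words_of_length n l. if take l v = u then word_mass s v else 0) =
      (\<Sum>v\<in>words_of_length n l. if v = u then word_mass s v else 0)"
    by (intro sum.cong refl) (simp add: length_words_of_length)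
  then show ?case
    using u finite_words_of_length by simp
next
  case (step k)
  have "(\<Sum>v\<in>words_of_length n (Suc k). if take l v = u then word_mass s v else 0) =
      (\<Sum>v\<in>words_of_length n k. \<Sum>i=1..n (Suc k).
         if take l v = u then word_mass s (v @ [i]) else 0)"
    using step.hyps unfolding sum_words_of_length_Suc
    by (intro sum.cong refl) (simp add: length_words_of_length)
  also have "\<dots> = (\<Sum>v\<in>words_of_length n k. if take l v = u then word_mass s v else 0)"
    by (intro sum.cong refl) (simp add: sum_word_mass_snoc del: One_nat_def)
  finally show ?case
    using step.IH by simp
qed

lemma sum_word_mass_level: "(\<Sum>v\<in>words_of_length n k. word_mass s v) = 1"
  using sum_word_mass_extensions[of "[]" 0 k s]
  by (simp add: words_of_length_0 word_mass_def level_sum_def)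

text \<open>Clearing the normalisation from total mass 1 expands the product of sums.\<close>

lemma sum_weight_powr: "(\<Sum>u\<in>words_of_length n k. word_weight c u powr s) = level_sum n c k s"
proof -
  have "(\<Sum>u\<in>words_of_length n k. word_weight c u powr s) / level_sum n c k s =
      (\<Sum>u\<in>words_of_length n k. word_mass s u)"
    unfolding sum_divide_distrib
    by (intro sum.cong refl) (simp add: word_mass_def length_words_of_length)
  then show ?thesis
    using level_sum_positive[of k s] by (simp add: sum_word_mass_level)
qed

text \<open>All covering words are compared at a common length \<open>k\<close>. Each piece of that
  level contains a point of \<open>E\<close>, so its word extends some \<open>u i\<close>, and its
  mass is counted at least once on the right.\<close>

lemma word_mass_cover:
  assumes "finite F" "\<And>i. i \<in> F \<Longrightarrow> u i \<in> words n" "E \<subseteq> (\<Union>i\<in>F. Jf (u i))"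
  shows "1 \<le> (\<Sum>i\<in>F. word_mass s (u i))"
proof -
  obtain k where k: "\<And>i. i \<in> F \<Longrightarrow> length (u i) \<le> k"
    using finite_nat_set_iff_bounded_le[of "(\<lambda>i. length (u i)) ` F"] \<open>finite F\<close> by auto
  have ex: "\<exists>i\<in>F. take (length (u i)) v = u i" if v: "v \<in> words_of_length n k" for v
  proof -
    obtain x where x: "x \<in> Jf v" "x \<in> E"
      using piece_meets_attractor[OF v] by blast
    then obtain i where i: "i \<in> F" "x \<in> Jf (u i)"
      using assms(3) by blast
    have "take (length (u i)) v = u i"
      using piece_word_unique[OF take_in_words_of_length[OF v k[OF i(1)]]
          words_in_words_of_length[OF assms(2)[OF i(1)]]]
        piece_subset_take[OF v k[OF i(1)]] x i by blast
    with i show ?thesis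
      by blast
  qed
  have "1 = (\<Sum>v\<in>words_of_length n k. word_mass s v)"
    by (simp add: sum_word_mass_level)
  also have "\<dots> \<le> (\<Sum>v\<in>words_of_length n k. \<Sum>i\<in>F.
      if take (length (u i)) v = u i then word_mass s v else 0)"
  proof (rule sum_mono)
    fix v assume "v \<in> words_of_length n k"
    then obtain i where "i \<in> F" "take (length (u i)) v = u i"
      using ex by blast
    then show "word_mass s v \<le> (\<Sum>i\<in>F. if take (length (u i)) v = u i then word_mass s v else 0)"
      using member_le_sum[of i F "\<lambda>i. if take (length (u i)) v = u i then word_mass s v else 0"]
        word_mass_nonneg \<open>finite F\<close> by auto
  qed
  also have "\<dots> = (\<Sum>i\<in>F. word_mass s (u i))"
    unfolding sum.swap[of _ F] using assms(2) k words_in_words_of_length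
    by (intro sum.cong refl sum_word_mass_extensions) auto
  finally show ?thesis .
qed

text \<open>
  The word is the longest one whose piece contains \<open>U \<inter> E\<close>, unless arbitrarily long ones exist, which
  is where \<open>\<epsilon>\<close> is needed. At the longest one \<open>U\<close> meets two different children, so the gap bounds
  its diameter from below.
\<close>

lemma small_mass_word:
  assumes s: "0 < s" and p: "0 < p" "\<And>k. p \<le> level_sum n c k s"
    and U: "bounded U" and \<epsilon>: "0 < \<epsilon>"
  obtains u where "u \<in> words n" "U \<inter> E \<subseteq> Jf u"
    "word_mass s u \<le> (diameter U / K) powr s / p + \<epsilon>"
proof -
  have mass_le: "word_mass s u \<le> word_weight c u powr s / p" for u
    unfolding word_mass_def using p level_sum_positive by (intro frac_le) auto
  \<comment> \<open>A weight below this threshold has \<open>s\<close>-th power below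
    \<open>\<epsilon> * p\<close>, hence mass below \<epsilon>.\<close>
  have "0 < (\<epsilon> * p) powr (1 / s)"
    using p \<epsilon> by simp
  from weights_small[OF this] obtain k1 where
    k1: "\<And>u. u \<in> words_of_length n k1 \<Longrightarrow> word_weight c u < (\<epsilon> * p) powr (1 / s)"
    by (auto simp: eventually_sequentially)
  let ?P = "\<lambda>l. \<exists>u\<in>words_of_length n l. U \<inter> E \<subseteq> Jf u"
  show ?thesis
  proof (cases "?P k1")
    case True
    then obtain u where u: "u \<in> words_of_length n k1" "U \<inter> E \<subseteq> Jf u"
      by blast
    have "word_weight c u powr s \<le> ((\<epsilon> * p) powr (1 / s)) powr s"
      using k1[OF u(1)] weight_pos[OF u(1)] s by (intro powr_mono2) auto
    also have "\<dots> = \<epsilon> * p"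
      using s p \<epsilon> by (simp add: powr_powr)
    finally have "word_weight c u powr s / p \<le> \<epsilon>"
      using p by (simp add: field_simps)
    moreover have "0 \<le> (diameter U / K) powr s / p"
      using p by simp
    ultimately have "word_mass s u \<le> (diameter U / K) powr s / p + \<epsilon>"
      using mass_le[of u] by linarith
    then show ?thesis
      using that u words_of_length_in_words by blast
  next
    case False
    have "?P 0"
      by (auto simp: words_of_length_0 elim!: attractor_pieceE[where k = 0])
    \<comment> \<open>The property holds at level 0 and fails at \<open>k1\<close>, so it is lost
      between two consecutive levels.\<close>
    have "\<exists>l. ?P l \<and> \<not> ?P (Suc l)"
    proof (rule ccontr)
      assume *: "\<not> (\<exists>l. ?P l \<and> \<not> ?P (Suc l))"
      have "?P l" for l
      proof (induction l)
        case 0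
        show ?case
          by (rule \<open>?P 0\<close>)
      next
        case (Suc l)
        with * show ?case
          by blast
      qed
      with False show False
        by blast
    qed
    then obtain l where l: "?P l" "\<not> ?P (Suc l)"
      by blast
    then obtain u where u: "u \<in> words_of_length n l" "U \<inter> E \<subseteq> Jf u"
      by blast
    have child: "\<exists>i\<in>{1..n (Suc l)}. x \<in> Jf (u @ [i])" if x: "x \<in> U \<inter> E" for x
    proof -
      obtain v where v: "v \<in> words_of_length n (Suc l)" "x \<in> Jf v"
        using x by (blast elim: attractor_pieceE)
      obtain u' i where v': "v = u' @ [i]" "u' \<in> words_of_length n l" "i \<in> {1..n (Suc l)}"
        using v(1) by (rule words_of_length_SucE)
      then have "u' = u"
        using piece_word_unique[OF v'(2) u(1)] piece_snoc_subset v x u(2) by blast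
      then show ?thesis
        using v v' by blast
    qed
    have no_child: "\<not> U \<inter> E \<subseteq> Jf (u @ [i])" if "i \<in> {1..n (Suc l)}" for i
      using l(2) u(1) that by (auto simp: snoc_in_words_of_length_iff)
    \<comment> \<open>An empty intersection would lie in the first child.\<close>
    have "U \<inter> E \<noteq> {}"
      using no_child[of 1] n_ge_1[of "Suc l"] by auto
    then obtain x i where x: "x \<in> U \<inter> E" "i \<in> {1..n (Suc l)}" "x \<in> Jf (u @ [i])"
      using child by blast
    obtain y where y: "y \<in> U \<inter> E" "y \<notin> Jf (u @ [i])"
      using no_child[OF x(2)] by blast
    then obtain j where j: "j \<in> {1..n (Suc l)}" "y \<in> Jf (u @ [j])"
      using child by blast
    have "K * word_weight c u \<le> dist x y"
      by (rule siblings_separated[OF u(1) x(2) j(1) _ x(3) j(2)]) (use y j in auto)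
    also have "\<dots> \<le> diameter U"
      using U x y by (intro diameter_bounded_bound) auto
    finally have "word_weight c u \<le> diameter U / K"
      using K_pos by (simp add: field_simps)
    then have "word_weight c u powr s / p \<le> (diameter U / K) powr s / p"
      using weight_pos[OF u(1)] s p by (intro divide_right_mono powr_mono2) auto
    then have "word_mass s u \<le> (diameter U / K) powr s / p + \<epsilon>"
      using mass_le[of u] \<epsilon> by linarith
    then show ?thesis
      using that u words_of_length_in_words by blast
  qed
qed

text \<open>Mass distribution principle. The estimate of \<open>small_mass_word\<close> works at
  every scale, so the bound does not depend on \<delta>.\<close>

lemma hausdorff_premeasure_lower_bound:
  assumes s: "0 < s" and p: "0 < p" "\<And>k. p \<le> level_sum n c k s"
  shows "ennreal (p * K powr s / 2) \<le> hausdorff_premeasure s \<delta> E"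
  unfolding hausdorff_premeasure_def
proof (rule INF_greatest)
  fix U :: "nat \<Rightarrow> 'a set"
  assume "U \<in> {U. E \<subseteq> (\<Union>i. U i) \<and> (\<forall>i. bounded (U i) \<and> diameter (U i) \<le> \<delta>)}"
  then have U: "E \<subseteq> (\<Union>i. U i)" "\<And>i. bounded (U i)"
    by auto
  \<comment> \<open>The errors sum to 1/2 over all \<open>i\<close>, which leaves at least half of
    the total mass to the diameters.\<close>
  have "\<exists>u. u \<in> words n \<and> U i \<inter> E \<subseteq> Jf u \<and>
      word_mass s u \<le> (diameter (U i) / K) powr s / p + (1 / 2) ^ Suc i / 2" for i
    by (rule small_mass_word[OF s p U(2), of "(1 / 2) ^ Suc i / 2" i]) auto
  then obtain u where u: "\<And>i. u i \<in> words n" "\<And>i. U i \<inter> E \<subseteq> Jf (u i)"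
      "\<And>i. word_mass s (u i) \<le> (diameter (U i) / K) powr s / p + (1 / 2) ^ Suc i / 2"
    by metis
  have "E \<subseteq> (\<Union>i. Jf (u i))"
  proof
    fix x assume "x \<in> E"
    then obtain i where "x \<in> U i"
      using U(1) by blast
    with \<open>x \<in> E\<close> show "x \<in> (\<Union>i. Jf (u i))"
      using u(2)[of i] by blast
  qed
  then obtain F where F: "finite F" "E \<subseteq> (\<Union>i\<in>F. Jf (u i))"
    by (rule finite_subcover_by_pieces[of u, OF u(1)])
  have geometric: "(\<Sum>i\<in>F. (1 / 2 :: real) ^ Suc i) \<le> 1"
    using sum_le_suminf[OF _ F(1), of "\<lambda>i. (1 / 2 :: real) ^ Suc i"] power_half_series
    by (simp add: sums_iff)
  have "1 \<le> (\<Sum>i\<in>F. word_mass s (u i))"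
    by (rule word_mass_cover[OF F(1) u(1) F(2)])
  also have "\<dots> \<le> (\<Sum>i\<in>F. (diameter (U i) / K) powr s / p + (1 / 2) ^ Suc i / 2)"
    by (intro sum_mono u(3))
  also have "\<dots> = (\<Sum>i\<in>F. (diameter (U i) / K) powr s / p) + (\<Sum>i\<in>F. (1 / 2) ^ Suc i) / 2"
    by (simp add: sum.distrib sum_divide_distrib)
  finally have "1 / 2 \<le> (\<Sum>i\<in>F. (diameter (U i) / K) powr s / p)"
    using geometric by linarith
  also have "\<dots> = (\<Sum>i\<in>F. diameter (U i) powr s) / (p * K powr s)"
    using K_pos diameter_ge_0[OF U(2)]
    by (simp add: sum_divide_distrib powr_divide mult.commute)
  finally have "p * K powr s / 2 \<le> (\<Sum>i\<in>F. diameter (U i) powr s)"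
    using K_pos p by (simp add: field_simps)
  then have "ennreal (p * K powr s / 2) \<le> ennreal (\<Sum>i\<in>F. diameter (U i) powr s)"
    by (rule ennreal_leI)
  also have "\<dots> = (\<Sum>i\<in>F. ennreal (diameter (U i) powr s))"
    by simp
  also have "\<dots> = (\<Sum>i\<in>F. diam_pow s (U i))"
    using s by (intro sum.cong) (auto simp: diam_pow_def)
  also have "\<dots> \<le> (\<Sum>i. diam_pow s (U i))"
    by (intro sum_le_suminf F(1)) auto
  finally show "ennreal (p * K powr s / 2) \<le> (\<Sum>i. diam_pow s (U i))" .
qed

text \<open>Exponent 0 is treated apart: \<open>small_mass_word\<close> uses \<open>1 / s\<close>,
  whereas \<open>diam_pow 0\<close> is 1 on every non-empty set. As \<open>E\<close> is non-empty,
  some covering set is too.\<close>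

lemma hausdorff_premeasure_0_lower_bound: "1 \<le> hausdorff_premeasure 0 \<delta> E"
  unfolding hausdorff_premeasure_def
proof (rule INF_greatest)
  fix U :: "nat \<Rightarrow> 'a set"
  assume "U \<in> {U. E \<subseteq> (\<Union>i. U i) \<and> (\<forall>i. bounded (U i) \<and> diameter (U i) \<le> \<delta>)}"
  then have "E \<subseteq> (\<Union>i. U i)"
    by simp
  moreover have "E \<noteq> {}"
    using piece_meets_attractor[of "[]" 0] by (auto simp: words_of_length_0)
  ultimately obtain i where "U i \<noteq> {}"
    by blast
  then have "1 = (\<Sum>i\<in>{i}. diam_pow 0 (U i))"
    by (simp add: diam_pow_def)
  also have "\<dots> \<le> (\<Sum>i. diam_pow 0 (U i))"
    by (rule sum_le_suminf) auto
  finally show "1 \<le> (\<Sum>i. diam_pow 0 (U i))" .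
qed

lemma hausdorff_measure_pos:
  assumes "0 \<le> s" and ev: "\<forall>\<^sub>F k in sequentially. 1 < level_sum n c k s"
  shows "hausdorff_measure s E \<noteq> 0"
proof -
  have "\<exists>b>0. b \<le> hausdorff_premeasure s 1 E"
  proof (cases "s = 0")
    case True
    then show ?thesis
      using hausdorff_premeasure_0_lower_bound[of 1] by (intro exI[of _ 1]) auto
  next
    case False
    obtain k0 where k0: "\<And>k. k0 \<le> k \<Longrightarrow> 1 < level_sum n c k s"
      using ev by (auto simp: eventually_sequentially)
    \<comment> \<open>The finitely many levels below \<open>k0\<close> have positive level sums; the
      inserted 1 accounts for the later ones, which exceed 1.\<close>
    define p where "p = Min (insert 1 ((\<lambda>k. level_sum n c k s) ` {..<k0}))"
    have "0 < p"
      unfolding p_def using level_sum_positive by (subst Min_gr_iff) auto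
    moreover have "p \<le> level_sum n c k s" for k
    proof (cases "k < k0")
      case True
      then show ?thesis
        unfolding p_def by (intro Min_le) auto
    next
      case k: False
      have "p \<le> 1"
        unfolding p_def by (intro Min_le) auto
      then show ?thesis
        using k0[of k] k by simp
    qed
    ultimately have "ennreal (p * K powr s / 2) \<le> hausdorff_premeasure s 1 E"
      using \<open>0 \<le> s\<close> False by (intro hausdorff_premeasure_lower_bound) auto
    then show ?thesis
      using \<open>0 < p\<close> K_pos by (intro exI[of _ "ennreal (p * K powr s / 2)"]) auto
  qed
  moreover have "hausdorff_premeasure s 1 E \<le> hausdorff_measure s E"
    unfolding hausdorff_measure_def by (rule SUP_upper) simp
  ultimately show ?thesis
    by (metis leD order.trans not_gr_zero)
qed

section \<open>Separated words and box counts\<close>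

lemma weight_le_1: "u \<in> words_of_length n k \<Longrightarrow> word_weight c u \<le> 1"
proof (induction k arbitrary: u)
  case (Suc k)
  obtain v i where "u = v @ [i]" "v \<in> words_of_length n k" "i \<in> {1..n (Suc k)}"
    using Suc.prems by (rule words_of_length_SucE)
  then show ?case
    using Suc.IH[of v] weight_snoc_le[of v k i] by simp
qed (simp add: words_of_length_0)

text \<open>As the words have equal length, one point of \<open>E\<close> chosen in each piece gives
  points more than \<open>K * \<rho>\<close> apart.\<close>

lemma card_large_weight_words:
  assumes "0 < \<rho>" "A \<subseteq> words_of_length n k" "\<And>u. u \<in> A \<Longrightarrow> \<rho> < word_weight c u"
  shows "card A \<le> box_count (K * \<rho>) E"
proof -
  have "\<forall>u\<in>A. \<exists>x. x \<in> Jf u \<inter> E"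
    using piece_meets_attractor assms(2) by blast
  then obtain x where x: "\<And>u. u \<in> A \<Longrightarrow> x u \<in> Jf u \<inter> E"
    by metis
  show ?thesis
  proof (rule box_count_lower_bound[OF compact_attractor])
    fix u v assume uv: "u \<in> A" "v \<in> A" "u \<noteq> v"
    have "K * \<rho> < K * word_weight c u"
      using assms(3)[OF uv(1)] K_pos by simp
    also have "\<dots> \<le> dist (x u) (x v)"
      using x uv assms(2) by (intro distinct_words_separated[of u k v]) auto
    finally show "K * \<rho> < dist (x u) (x v)" .
  qed (use x assms(1) K_pos in auto)
qed

text \<open>
  Words of one length whose weights lie in \<open>(2\<^bsup>-j-1\<^esup>, 2\<^bsup>-j\<^esup>]\<close> have pieces at mutual distance larger than
  \<open>K 2\<^bsup>-j-1\<^esup>\<close>. If \<open>E\<close> had upper box dimension less than \<open>s\<close>, the level sum at \<open>t > s\<close> would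
  thus be dominated by the tail of a geometric series.
\<close>

lemma upper_box_dim_lower_bound:
  assumes "s < t" and freq: "\<exists>\<^sub>F k in sequentially. 1 < level_sum n c k t"
  shows "ereal s \<le> upper_box_dim E"
proof (rule ccontr)
  assume "\<not> ereal s \<le> upper_box_dim E"
  then have "Limsup (at_right 0) (\<lambda>\<delta>. ereal (ln (real (box_count \<delta> E)) / - ln \<delta>)) < ereal s"
    by (simp add: upper_box_dim_def)
  from Limsup_lessD[OF this] obtain b where b: "0 < b"
      "\<And>\<delta>. 0 < \<delta> \<Longrightarrow> \<delta> < b \<Longrightarrow> ln (real (box_count \<delta> E)) / - ln \<delta> < s"
    unfolding eventually_at_right_field less_ereal.simps by blast
  have count: "real (box_count \<delta> E) \<le> \<delta> powr - s" if \<delta>: "0 < \<delta>" "\<delta> < min b 1" for \<delta>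
  proof (cases "box_count \<delta> E = 0")
    case False
    have *: "ln (real (box_count \<delta> E)) < s * (- ln \<delta>)"
      using b(2)[of \<delta>] \<delta> by (simp add: pos_divide_less_eq field_simps)
    have "real (box_count \<delta> E) = exp (ln (real (box_count \<delta> E)))"
      using False by simp
    also have "\<dots> \<le> exp (- s * ln \<delta>)"
      using * by simp
    also have "\<dots> = \<delta> powr - s"
      using \<delta> by (simp add: powr_def)
    finally show ?thesis .
  qed simp
  define r :: real where "r = 1 / 2"
  define q where "q = r powr (t - s)"
  \<comment> \<open>This gathers what does not depend on \<open>j\<close>: the first two factors
    come from the count at scale \<open>K * r ^ Suc j\<close>, the last one from
    \<open>term_le\<close>.\<close>
  define A where "A = K powr - s * r powr - s * 2 powr \<bar>t\<bar>"
  have r: "0 < r" "r < 1"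
    by (simp_all add: r_def)
  have "0 < A"
    using K_pos r by (simp add: A_def)
  have q: "0 < q" "q < 1"
    using powr_less_mono'[OF r, of 0 "t - s"] r \<open>s < t\<close> by (simp_all add: q_def)
  have "summable (\<lambda>j. A * q ^ j)"
    using q by (intro summable_mult summable_geometric) simp
  from summable_partial_sum_bound[OF this zero_less_one] obtain m1 where
    m1: "\<And>m l. m1 \<le> m \<Longrightarrow> norm (\<Sum>j=m..l. A * q ^ j) < 1"
    by metis
  have "0 < min b 1 / K"
    using b(1) K_pos by simp
  then obtain m2 where m2: "r ^ m2 < min b 1 / K"
    using real_arch_pow_inv r(2) by blast
  \<comment> \<open>From \<open>m0\<close> on, the scales \<open>K * r ^ Suc j\<close> are small
    enough for \<open>count\<close>, and sums of the geometric series over blocks stay below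
    1.\<close>
  define m0 where "m0 = max m1 m2"
  \<comment> \<open>The level is chosen after \<open>m0\<close>: level sums above 1 recur infinitely
    often and all weights are eventually below \<open>r ^ m0\<close>, so some level has both
    properties.\<close>
  obtain k where k: "1 < level_sum n c k t" "\<And>u. u \<in> words_of_length n k \<Longrightarrow> word_weight c u < r ^ m0"
    using frequently_ex[OF frequently_eventually_frequently[OF freq weights_small[of "r ^ m0"]]] r
    by auto
  \<comment> \<open>The dyadic band of \<open>u\<close>: minimality bounds the weight above by
    \<open>r ^ lev u\<close>, except in band 0, where \<open>weight_le_1\<close> does.\<close>
  define lev where "lev u = (LEAST j. r ^ Suc j < word_weight c u)" for u
  have lev_less: "r ^ Suc (lev u) < word_weight c u" if u: "u \<in> words_of_length n k" for u
  proof -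
    obtain j where "r ^ j < word_weight c u"
      using real_arch_pow_inv[OF weight_pos[OF u] r(2)] by blast
    moreover have "r ^ Suc j \<le> r ^ j"
      using r by (intro power_decreasing) auto
    ultimately show ?thesis
      unfolding lev_def by (intro LeastI[of "\<lambda>j. r ^ Suc j < word_weight c u" j]) linarith
  qed
  have lev_ge: "word_weight c u \<le> r ^ lev u" if u: "u \<in> words_of_length n k" for u
  proof (cases "lev u")
    case 0
    then show ?thesis
      using weight_le_1[OF u] by simp
  next
    case (Suc j)
    then have "\<not> r ^ Suc j < word_weight c u"
      unfolding lev_def by (intro not_less_Least) simp
    then show ?thesis
      using Suc by simp
  qed
  have lev_m0: "m0 \<le> lev u" if u: "u \<in> words_of_length n k" for u
  proof -
    have "r ^ Suc (lev u) < r ^ m0"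
      using lev_less[OF u] k(2)[OF u] by simp
    then show ?thesis
      using r by (simp only: power_strict_decreasing_iff)
  qed
  \<comment> \<open>The sign of \<open>t\<close> is not fixed. For \<open>t < 0\<close> the power is
    largest at the lower end of the band, which costs the factor \<open>r powr t\<close>, equal to
    \<open>2 powr \<bar>t\<bar>\<close>.\<close>
  have term_le: "word_weight c u powr t \<le> 2 powr \<bar>t\<bar> * (r ^ lev u) powr t"
    if u: "u \<in> words_of_length n k" for u
  proof (cases "0 \<le> t")
    case True
    then have "word_weight c u powr t \<le> (r ^ lev u) powr t"
      using lev_ge[OF u] weight_pos[OF u] by (intro powr_mono2) auto
    also have "\<dots> \<le> 2 powr \<bar>t\<bar> * (r ^ lev u) powr t"
      using mult_right_mono[of 1 "2 powr \<bar>t\<bar>" "(r ^ lev u) powr t"] ge_one_powr_ge_zero[of 2 "\<bar>t\<bar>"]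
      by simp
    finally show ?thesis .
  next
    case False
    then have "word_weight c u powr t \<le> (r ^ Suc (lev u)) powr t"
      using lev_less[OF u] r by (intro powr_mono2') auto
    also have "\<dots> = r powr t * (r ^ lev u) powr t"
      using r by (simp add: powr_mult)
    also have "r powr t = 2 powr \<bar>t\<bar>"
      using False by (simp add: r_def powr_minus_divide powr_divide)
    finally show ?thesis .
  qed
  have level: "(\<Sum>u | u \<in> words_of_length n k \<and> lev u = j. word_weight c u powr t) \<le> A * q ^ j"
    if j: "m0 \<le> j" for j
  proof -
    let ?G = "{u \<in> words_of_length n k. lev u = j}"
    have "r ^ Suc j \<le> r ^ m2"
      using j r by (intro power_decreasing) (auto simp: m0_def)
    then have "K * r ^ Suc j \<le> K * r ^ m2"
      using K_pos by (intro mult_left_mono) auto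
    also have "\<dots> < min b 1"
      using m2 K_pos by (simp add: pos_less_divide_eq mult.commute)
    finally have "K * r ^ Suc j < min b 1" .
    moreover have "0 < K * r ^ Suc j"
      using K_pos r by simp
    ultimately have "real (box_count (K * r ^ Suc j) E) \<le> (K * r ^ Suc j) powr - s"
      by (intro count)
    moreover have "card ?G \<le> box_count (K * r ^ Suc j) E"
      using lev_less r by (intro card_large_weight_words) auto
    ultimately have card: "real (card ?G) \<le> (K * r ^ Suc j) powr - s"
      by linarith
    have "(\<Sum>u\<in>?G. word_weight c u powr t) \<le> (\<Sum>u\<in>?G. 2 powr \<bar>t\<bar> * (r ^ j) powr t)"
      using term_le by (intro sum_mono) auto
    also have "\<dots> = real (card ?G) * (2 powr \<bar>t\<bar> * (r ^ j) powr t)"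
      by simp
    also have "\<dots> \<le> (K * r ^ Suc j) powr - s * (2 powr \<bar>t\<bar> * (r ^ j) powr t)"
      using card by (intro mult_right_mono) auto
    also have "\<dots> = A * ((r ^ j) powr - s * (r ^ j) powr t)"
      using K_pos r by (simp add: A_def powr_mult)
    also have "(r ^ j) powr - s * (r ^ j) powr t = (r ^ j) powr (t - s)"
      by (simp flip: powr_add)
    also have "\<dots> = q ^ j"
      using r by (simp add: q_def powr_powr mult.commute flip: powr_realpow)
    finally show ?thesis
      by simp
  qed
  let ?L = "lev ` words_of_length n k"
  have "finite ?L"
    using finite_words_of_length by simp
  then obtain M where M: "?L \<subseteq> {m0..M}"
    using finite_nat_set_iff_bounded_le[of ?L] lev_m0 by fastforce
  have "level_sum n c k t = (\<Sum>j\<in>?L. \<Sum>u | u \<in> words_of_length n k \<and> lev u = j. word_weight c u powr t)"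
    unfolding sum_weight_powr[symmetric] by (rule sum.image_gen[OF finite_words_of_length])
  also have "\<dots> \<le> (\<Sum>j\<in>?L. A * q ^ j)"
    using lev_m0 by (intro sum_mono level) auto
  also have "\<dots> \<le> (\<Sum>j=m0..M. A * q ^ j)"
    using M \<open>0 < A\<close> q by (intro sum_mono2) auto
  also have "\<dots> < 1"
    using m1[of m0 M] by (simp add: m0_def)
  finally show False
    using k(1) by simp
qed

end

section \<open>Non-autonomous attractors\<close>

text \<open>A prefix of \<open>u @ [i]\<close> no longer than \<open>u\<close> is a prefix of
  \<open>u\<close>, so the outer factors do not change and the new map enters innermost.\<close>

lemma word_map_snoc: "word_map S \<omega> (u @ [i]) = word_map S \<omega> u \<circ> level_map S \<omega> (u @ [i])"
proof -
  have foldr_comp: "foldr (\<lambda>j f. g j \<circ> f) xs h = foldr (\<lambda>j f. g j \<circ> f) xs id \<circ> h"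
    for g :: "nat \<Rightarrow> 'a \<Rightarrow> 'a" and xs h
    by (induction xs) (simp_all add: comp_assoc)
  have "foldr (\<lambda>j f. level_map S \<omega> (take j (u @ [i])) \<circ> f) [1..<Suc (length u)] h =
      foldr (\<lambda>j f. level_map S \<omega> (take j u) \<circ> f) [1..<Suc (length u)] h" for h
    by (rule foldr_cong) auto
  moreover have "[1..<Suc (length (u @ [i]))] = [1..<Suc (length u)] @ [Suc (length u)]"
    by simp
  ultimately have "word_map S \<omega> (u @ [i]) =
      foldr (\<lambda>j f. level_map S \<omega> (take j u) \<circ> f) [1..<Suc (length u)] (level_map S \<omega> (u @ [i]))"
    unfolding word_map_def by (simp del: upt_Suc)
  also have "\<dots> = foldr (\<lambda>j f. level_map S \<omega> (take j u) \<circ> f) [1..<Suc (length u)] id \<circ>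
      level_map S \<omega> (u @ [i])"
    by (rule foldr_comp)
  also have "\<dots> = word_map S \<omega> u \<circ> level_map S \<omega> (u @ [i])"
    by (simp only: word_map_def)
  finally show ?thesis .
qed

text \<open>Removing the last letter removes the map applied first. Its translation cancels in
  differences, and \<open>maps_within\<close> keeps the image points in \<open>J\<close>, where the
  induction hypothesis applies.\<close>

lemma word_map_lower_lipschitz:
  fixes J :: "'a::euclidean_space set"
  assumes within: "maps_within n J S \<omega>"
    and c: "\<And>k i. 1 \<le> k \<Longrightarrow> i \<in> {1..n k} \<Longrightarrow> 0 \<le> c k i"
    and S: "\<And>k i x y. 1 \<le> k \<Longrightarrow> i \<in> {1..n k} \<Longrightarrow> x \<in> J \<Longrightarrow> y \<in> J \<Longrightarrow>
              c k i * norm (x - y) \<le> norm (S k i x - S k i y)"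
    and "u \<in> words_of_length n k" "x \<in> J" "y \<in> J"
  shows "word_weight c u * dist x y \<le> dist (word_map S \<omega> u x) (word_map S \<omega> u y)"
  using assms(4-)
proof (induction k arbitrary: u x y)
  case 0
  then show ?case
    by (simp add: words_of_length_0 word_map_def)
next
  case (Suc k)
  obtain v i where u: "u = v @ [i]" "v \<in> words_of_length n k" "i \<in> {1..n (Suc k)}"
    using Suc.prems(1) by (rule words_of_length_SucE)
  let ?g = "level_map S \<omega> u"
  have g: "?g z \<in> J" if "z \<in> J" for z
    using within that words_of_length_in_words[OF Suc.prems(1)] u(1)
    by (auto simp: maps_within_def)
  have "0 \<le> word_weight c v"
    using u(2) unfolding word_weight_def words_of_length_def by (intro prod_nonneg c) auto
  moreover have "c (Suc k) i * dist x y \<le> dist (?g x) (?g y)"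
    using S[of "Suc k" i x y] u(3) Suc.prems(2,3) length_words_of_length[OF u(2)] u(1)
    by (simp add: level_map_def dist_norm)
  ultimately have "word_weight c v * (c (Suc k) i * dist x y) \<le> word_weight c v * dist (?g x) (?g y)"
    by (rule mult_left_mono[rotated])
  also have "\<dots> \<le> dist (word_map S \<omega> v (?g x)) (word_map S \<omega> v (?g y))"
    using Suc.IH[OF u(2)] g Suc.prems(2,3) by blast
  finally show ?case
    using u(1) by (simp add: word_weight_snoc word_map_snoc length_words_of_length[OF u(2)] mult_ac)
qed

theorem theorem2p2:
  fixes n :: "nat \<Rightarrow> nat"
    and J :: "'a::euclidean_space set"
    and S :: "nat \<Rightarrow> nat \<Rightarrow> 'a \<Rightarrow> 'a"
    and \<omega> :: "nat list \<Rightarrow> 'a"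
    and Jf :: "nat list \<Rightarrow> 'a set"
    and c :: "nat \<Rightarrow> nat \<Rightarrow> real"
  assumes n_ge_2: "\<And>k. 1 \<le> k \<Longrightarrow> 2 \<le> n k"
    and J_compact: "compact J"
    and J_interior: "interior J \<noteq> {}"
    and S_contractive: "\<And>k i. 1 \<le> k \<Longrightarrow> i \<in> {1..n k} \<Longrightarrow> contractive (S k i)"
    and struct: "nonautonomous_structure n J S \<omega> Jf"
    and within: "maps_within n J S \<omega>"
    and gap: "gap_separation n Jf"
    and c_range: "\<And>k i. 1 \<le> k \<Longrightarrow> i \<in> {1..n k} \<Longrightarrow> 0 < c k i \<and> c k i < 1"
    and S_lower: "\<And>k i x y. 1 \<le> k \<Longrightarrow> i \<in> {1..n k} \<Longrightarrow> x \<in> J \<Longrightarrow> y \<in> J \<Longrightarrow>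
                    c k i * norm (x - y) \<le> norm (S k i x - S k i y)"
  shows "hausdorff_dim (nonautonomous_attractor n Jf)
           \<ge> liminf (\<lambda>k. ereal (level_exponent n c k))
       \<and> upper_box_dim (nonautonomous_attractor n Jf)
           \<ge> limsup (\<lambda>k. ereal (level_exponent n c k))"
proof -
  have n_ge_1: "1 \<le> n k" if "1 \<le> k" for k
    using n_ge_2[OF that] by simp
  obtain C where C: "0 < C" and gapC: "\<And>u i j. u \<in> words n \<Longrightarrow> i \<in> {1..n (length u + 1)} \<Longrightarrow>
      j \<in> {1..n (length u + 1)} \<Longrightarrow> i \<noteq> j \<Longrightarrow>
      C * diameter (Jf u) \<le> setdist (Jf (u @ [i])) (Jf (u @ [j]))"
    using gap unfolding gap_separation_def by blast
  have Jf: "closed (Jf u)" "Jf u \<subseteq> J" "Jf u = word_map S \<omega> u ` J" if "u \<in> words n" for u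
    using struct that unfolding nonautonomous_structure_def by blast+
  have nested: "Jf (u @ [i]) \<subseteq> Jf u" if "u \<in> words_of_length n k" "i \<in> {1..n (Suc k)}" for k u i
    using struct that unfolding nonautonomous_structure_def by (metis diff_Suc_1 le_add1 plus_1_eq_Suc)
  have diam_lim: "(\<lambda>k. Max ((\<lambda>u. diameter (Jf u)) ` words_of_length n k)) \<longlonglongrightarrow> 0"
    using struct unfolding nonautonomous_structure_def by blast
  have "J \<noteq> {}"
    using J_interior interior_subset by auto
  \<comment> \<open>The interior contains a ball. This makes the gap constant
    \<open>C * diameter J\<close> positive and allows division by \<open>diameter J\<close>.\<close>
  have "0 < diameter J"
  proof -
    obtain x e where "0 < e" and e: "cball x e \<subseteq> J"
      using J_interior mem_interior_cball by blast
    then have "diameter (cball x e) \<le> diameter J"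
      using J_compact by (intro diameter_subset compact_imp_bounded)
    then show ?thesis
      using \<open>0 < e\<close> by simp
  qed
  have diam_ge: "word_weight c u * diameter J \<le> diameter (Jf u)" if u: "u \<in> words_of_length n k" for k u
  proof -
    obtain x y where xy: "x \<in> J" "y \<in> J" "dist x y = diameter J"
      using diameter_compact_attained[OF J_compact \<open>J \<noteq> {}\<close>] by blast
    have uw: "u \<in> words n"
      using u by (rule words_of_length_in_words)
    have "word_weight c u * dist x y \<le> dist (word_map S \<omega> u x) (word_map S \<omega> u y)"
      using c_range by (intro word_map_lower_lipschitz[OF within _ S_lower u xy(1,2)]) (auto intro: less_imp_le)
    also have "\<dots> \<le> diameter (Jf u)"
      using Jf[OF uw] xy J_compact
      by (intro diameter_bounded_bound) (auto intro: bounded_subset compact_imp_bounded)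
    finally show ?thesis
      using xy(3) by simp
  qed
  interpret gap_separated_code n c Jf "C * diameter J"
  proof
    fix u assume u: "u \<in> words n"
    show "compact (Jf u)"
      using Jf(1,2)[OF u] J_compact by (metis closed_Int_compact inf.absorb1)
    show "Jf u \<noteq> {}"
      using Jf(3)[OF u] \<open>J \<noteq> {}\<close> by simp
  next
    fix k u i j x y
    assume u: "u \<in> words_of_length n k" and ij: "i \<in> {1..n (Suc k)}" "j \<in> {1..n (Suc k)}" "i \<noteq> j"
      and xy: "x \<in> Jf (u @ [i])" "y \<in> Jf (u @ [j])"
    have "C * diameter J * word_weight c u \<le> C * diameter (Jf u)"
      using diam_ge[OF u] C by (simp add: mult.commute)
    also have "\<dots> \<le> setdist (Jf (u @ [i])) (Jf (u @ [j]))"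
      using ij length_words_of_length[OF u] by (intro gapC words_of_length_in_words[OF u]) auto
    also have "\<dots> \<le> dist x y"
      using xy by (rule setdist_le_dist)
    finally show "C * diameter J * word_weight c u \<le> dist x y" .
  next
    \<comment> \<open>By \<open>diam_ge\<close> a weight is at most the ratio of the diameters of
      its piece and of \<open>J\<close>, so vanishing diameters make the weights uniformly
      small.\<close>
    fix \<epsilon> :: real assume "0 < \<epsilon>"
    then have "0 < \<epsilon> * diameter J"
      using \<open>0 < diameter J\<close> by simp
    with diam_lim have "\<forall>\<^sub>F k in sequentially.
        Max ((\<lambda>u. diameter (Jf u)) ` words_of_length n k) < \<epsilon> * diameter J"
      by (rule order_tendstoD(2))
    then show "\<forall>\<^sub>F k in sequentially. \<forall>u\<in>words_of_length n k. word_weight c u < \<epsilon>"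
    proof eventually_elim
      case (elim k)
      show ?case
      proof
        fix u assume u: "u \<in> words_of_length n k"
        have "word_weight c u * diameter J \<le> diameter (Jf u)"
          by (rule diam_ge[OF u])
        also have "\<dots> \<le> Max ((\<lambda>u. diameter (Jf u)) ` words_of_length n k)"
          using u finite_words_of_length by (intro Max_ge) auto
        also note elim
        finally show "word_weight c u < \<epsilon>"
          using \<open>0 < diameter J\<close> by simp
      qed
    qed
  qed (use n_ge_1 c_range C \<open>0 < diameter J\<close> nested in \<open>auto intro: less_imp_le\<close>)
  have gt_1: "1 < level_sum n c k s" if "1 \<le> k" "ereal s < ereal (level_exponent n c k)" for k s
    using that c_range by (intro level_sum_gt_1 n_ge_1) auto
  show ?thesis
  proof
    show "liminf (\<lambda>k. ereal (level_exponent n c k)) \<le> hausdorff_dim (nonautonomous_attractor n Jf)"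
      unfolding hausdorff_dim_def
    proof (rule INF_greatest, rule ccontr)
      \<comment> \<open>An exponent below the liminf gives level sums above 1 from some level on,
        hence a nonzero measure.\<close>
      fix s assume s: "s \<in> {s. 0 \<le> s \<and> hausdorff_measure s (nonautonomous_attractor n Jf) = 0}"
        and "\<not> liminf (\<lambda>k. ereal (level_exponent n c k)) \<le> ereal s"
      then have "\<forall>\<^sub>F k in sequentially. ereal s < ereal (level_exponent n c k)"
        by (intro less_LiminfD) simp
      then have "\<forall>\<^sub>F k in sequentially. 1 < level_sum n c k s"
        using eventually_ge_at_top[of 1] by eventually_elim (rule gt_1)
      from hausdorff_measure_pos[OF _ this] s show False
        by simp
    qed
    show "limsup (\<lambda>k. ereal (level_exponent n c k)) \<le> upper_box_dim (nonautonomous_attractor n Jf)"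
    proof (rule ccontr)
      assume "\<not> limsup (\<lambda>k. ereal (level_exponent n c k)) \<le> upper_box_dim (nonautonomous_attractor n Jf)"
      \<comment> \<open>Two exponents are inserted, since \<open>upper_box_dim_lower_bound\<close>
        needs room between \<open>s\<close> and \<open>t\<close> for its geometric ratio to be below
        1.\<close>
      then obtain s where s: "upper_box_dim (nonautonomous_attractor n Jf) < ereal s"
          "ereal s < limsup (\<lambda>k. ereal (level_exponent n c k))"
        using ereal_dense2 by (metis not_le)
      then obtain t where t: "s < t" "ereal t < limsup (\<lambda>k. ereal (level_exponent n c k))"
        using ereal_dense2 by (metis ereal_less(2) less_ereal.simps(1))
      have "\<exists>\<^sub>F k in sequentially. ereal t < ereal (level_exponent n c k)"
      proof (rule ccontr)
        assume "\<not> ?thesis"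
        then have "\<forall>\<^sub>F k in sequentially. ereal (level_exponent n c k) \<le> ereal t"
          by (simp only: not_frequently not_less)
        from Limsup_bounded[OF this] t(2) show False
          by simp
      qed
      from frequently_eventually_frequently[OF this eventually_ge_at_top[of 1]]
      have "\<exists>\<^sub>F k in sequentially. 1 < level_sum n c k t"
        by (rule frequently_elim1) (use gt_1 in auto)
      with upper_box_dim_lower_bound[OF t(1)] s(1) show False
        by simp
    qed
  qed
qed

end
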